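(* Let $n, m \ge 1$ be integers and let $P(\lambda) = I\lambda^m + A_{m-1}\lambda^{m-1} + \cdots + A_1\lambda + A_0$ be an $n\times n$ monic matrix polynomial, where $A_l \in M_n(\mathbb{C})$ for $0 \le l \le m-1$ and $I$ is the $n\times n$ identity matrix. For $1 \le i \le n$ let $p_{ii}(\lambda)$ denote the $i$th diagonal entry of $P(\lambda)$, a scalar polynomial. Then the sum of all eigenvalues of $P(\lambda)$, counted with algebraic multiplicity, equals the sum of the roots, counted with multiplicity, of the scalar polynomial $\prod_{i=1}^{n} p_{ii}(\lambda)$.
   Context: $M_n(\mathbb{C})$ is the set of $n\times n$ complex matrices. A matrix polynomial $P(\lambda)=\sum_{l=0}^m A_l\lambda^l$ with $A_l=[a_l^{(ij)}]\in M_n(\mathbb{C})$ is viewed as an $n\times n$ matrix $[p_{ij}(\lambda)]$ of scalar polynomials $p_{ij}(\lambda)=\sum_{l=0}^m a_l^{(ij)}\lambda^l$. When the leading coefficient is nonsingular (in particular when it is $I$), the eigenvalues of $P(\lambda)$ are the complex numbers $\lambda_0$ with $\det P(\lambda_0)=0$; the algebraic multiplicity of an eigenvalue is its multiplicity as a root of the scalar polynomial $\det P(\lambda)$, and there are exactly $mn$ eigenvalues counted with algebraic multiplicity. *)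

theory Defs
  imports
    Jordan_Normal_Form.Determinant
    "HOL-Computational_Algebra.Polynomial"
begin

definition mat_poly :: "nat \<Rightarrow> nat \<Rightarrow> (nat \<Rightarrow> complex mat) \<Rightarrow> complex poly mat" where
  "mat_poly n m A = mat n n (\<lambda>(i, j). \<Sum>l\<le>m. monom (A l $$ (i, j)) l)"

definition eval_mat_poly :: "complex poly mat \<Rightarrow> complex \<Rightarrow> complex mat" where
  "eval_mat_poly P z = map_mat (\<lambda>p. poly p z) P"

text \<open>This is the notion of eigenvalue for a nonsingular leading coefficient (no eigenvalue at
  infinity).  Then \<open>det P\<close> is a nonzero polynomial, so the set of eigenvalues is finite.\<close>

definition mp_eigenvalues :: "complex poly mat \<Rightarrow> complex set" where
  "mp_eigenvalues P = {z. det (eval_mat_poly P z) = 0}"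

text \<open>Here \<open>det P\<close> is taken over the ring of polynomials.\<close>

definition alg_mult :: "complex poly mat \<Rightarrow> complex \<Rightarrow> nat" where
  "alg_mult P z = order z (det P)"

end

theory Submission
  imports Defs "HOL-Computational_Algebra.Fundamental_Theorem_Algebra"
begin

text \<open>A permutation other than the identity moves at least two indices, and off-diagonal entries of
  \<open>P\<close> have degree at most \<open>m - 1\<close>. So in the Leibniz expansion \<open>det P\<close> differs from the product of
  its diagonal entries only in degrees at most \<open>n * m - 2\<close>. Both polynomials are therefore monic
  of degree \<open>n * m\<close> with the same subleading coefficient, and by Vieta that coefficient determines
  the sum of the roots.\<close>

text \<open>Multiplying by the variable (\<open>pCons 0\<close>) avoids the truncated index \<open>size M - 1\<close> for empty \<open>M\<close>.\<close>

lemma coeff_prod_mset_linear_factors: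
  fixes M :: "'a::idom multiset"
  shows "degree (\<Prod>x\<in>#M. [:- x, 1:]) = size M"
    and "coeff (\<Prod>x\<in>#M. [:- x, 1:]) (size M) = 1"
    and "coeff (pCons 0 (\<Prod>x\<in>#M. [:- x, 1:])) (size M) = - sum_mset M"
proof (induction M)
  case (add x M)
  define q where "q = (\<Prod>x\<in>#M. [:- x, 1:])"
  have q: "degree q = size M" "coeff q (size M) = 1" "coeff (pCons 0 q) (size M) = - sum_mset M"
    using add by (simp_all add: q_def)
  have "q \<noteq> 0" using q(2) by auto
  then have deg: "degree ([:- x, 1:] * q) = Suc (size M)"
    using q(1) by (subst degree_mult_eq) auto
  \<comment> \<open>Multiplying by \<open>[:- x, 1:]\<close> adds a shifted copy of \<open>q\<close>
    to \<open>- x\<close> times \<open>q\<close>; at the new top degree only the shifted copy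
    contributes.\<close>
  have zero: "coeff q (Suc (size M)) = 0" using q(1) by (simp add: coeff_eq_0)
  show "degree (\<Prod>x\<in>#add_mset x M. [:- x, 1:]) = size (add_mset x M)"
    using deg by (simp add: q_def)
  show "coeff (\<Prod>x\<in>#add_mset x M. [:- x, 1:]) (size (add_mset x M)) = 1"
    using q zero by (simp add: q_def)
  show "coeff (pCons 0 (\<Prod>x\<in>#add_mset x M. [:- x, 1:])) (size (add_mset x M))
      = - sum_mset (add_mset x M)"
    using q by (simp add: q_def)
qed simp_all

text \<open>Over the complex numbers a monic polynomial is the product of the linear factors of its
  roots, so Vieta's formula applies.\<close>

lemma sum_mset_proots_monic:
  fixes p :: "complex poly"
  assumes "lead_coeff p = 1"
  shows "sum_mset (proots p) = - coeff (pCons 0 p) (degree p)"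
proof -
  have p: "(\<Prod>x\<in>#proots p. [:- x, 1:]) = p"
    using complex_poly_decompose_multiset[of p] assms by simp
  show ?thesis
    using coeff_prod_mset_linear_factors(1,3)[of "proots p"] unfolding p by simp
qed

lemma sum_mset_multiplicity:
  fixes M :: "'a::semiring_1 multiset"
  shows "sum_mset M = (\<Sum>z\<in>set_mset M. of_nat (count M z) * z)"
proof (induction M)
  case (add x M)
  have "(\<Sum>z\<in>insert x (set_mset M). of_nat (count (add_mset x M) z) * z)
      = (\<Sum>z\<in>insert x (set_mset M). of_nat (count M z) * z + (if z = x then z else 0))"
    by (intro sum.cong) (auto simp: algebra_simps)
  also have "\<dots> = (\<Sum>z\<in>insert x (set_mset M). of_nat (count M z) * z) + x"
    by (simp add: sum.distrib)
  \<comment> \<open>If \<open>x\<close> is not in \<open>M\<close>, its count there is 0, so the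
    extra index contributes nothing.\<close>
  also have "(\<Sum>z\<in>insert x (set_mset M). of_nat (count M z) * z) = sum_mset M"
    unfolding add by (intro sum.mono_neutral_right) (auto simp: not_in_iff)
  finally show ?case by (simp add: add.commute)
qed simp

lemma sum_mset_proots:
  fixes p :: "'a::idom poly"
  assumes "p \<noteq> 0"
  shows "sum_mset (proots p) = (\<Sum>z | poly p z = 0. of_nat (order z p) * z)"
  using assms by (simp add: sum_mset_multiplicity)

text \<open>If \<open>i\<close> is moved, injectivity forces \<open>p i\<close> to be moved as
  well.\<close>

lemma permutes_moves_two:
  assumes "p permutes S" "finite S" "p \<noteq> id"
  shows "2 \<le> card {i \<in> S. p i \<noteq> i}"
proof -
  obtain i where i: "p i \<noteq> i" using assms(3) by (auto simp: fun_eq_iff)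
  then have "i \<in> S" using assms(1) by (auto simp: permutes_def)
  moreover have "p i \<in> S" using \<open>i \<in> S\<close> assms(1) by (simp add: permutes_in_image)
  moreover have "p (p i) \<noteq> p i" using i permutes_inj[OF assms(1)] by (auto dest: injD)
  ultimately have "{i, p i} \<subseteq> {i \<in> S. p i \<noteq> i}" using i by auto
  then have "card {i, p i} \<le> card {i \<in> S. p i \<noteq> i}" using assms(2) by (intro card_mono) auto
  then show ?thesis using i by simp
qed

text \<open>Each moved index selects an off-diagonal entry and costs at least one degree, and at
  least two indices are moved. Adding 2 on the left avoids truncated subtraction.\<close>

lemma degree_prod_permutation:
  fixes P :: "'a::idom poly mat"
  assumes p: "p permutes {0..<n}" "p \<noteq> id"
    and diag: "\<And>i. i < n \<Longrightarrow> degree (P $$ (i, i)) \<le> m"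
    and offdiag: "\<And>i j. i < n \<Longrightarrow> j < n \<Longrightarrow> i \<noteq> j \<Longrightarrow> degree (P $$ (i, j)) < m"
  shows "degree (\<Prod>i = 0..<n. P $$ (i, p i)) + 2 \<le> n * m"
proof -
  have "degree (\<Prod>i = 0..<n. P $$ (i, p i)) + 2
      \<le> (\<Sum>i = 0..<n. degree (P $$ (i, p i))) + card {i \<in> {0..<n}. p i \<noteq> i}"
    using degree_prod_sum_le[of "{0..<n}" "\<lambda>i. P $$ (i, p i)"] permutes_moves_two[OF p(1) _ p(2)]
    by (intro add_mono) auto
  \<comment> \<open>Counting moved indices by indicators lets the bound be checked factor by
    factor.\<close>
  also have "\<dots> = (\<Sum>i = 0..<n. degree (P $$ (i, p i)) + (if p i \<noteq> i then 1 else 0))"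
    by (simp only: sum.distrib card_eq_sum sum.inter_filter finite_atLeastLessThan)
  also have "\<dots> \<le> (\<Sum>i = 0..<n. m)"
  proof (rule sum_mono)
    fix i assume "i \<in> {0..<n}"
    then have "i < n" "p i < n" using permutes_in_image[OF p(1), of i] by auto
    then show "degree (P $$ (i, p i)) + (if p i \<noteq> i then 1 else 0) \<le> m"
      using diag[of i] offdiag[of i "p i"] by auto
  qed
  finally show ?thesis by simp
qed

text \<open>The condition on \<open>k\<close> says \<open>k \<ge> n * m - 1\<close>, a range that no
  Leibniz term of a non-identity permutation reaches.\<close>

lemma coeff_det_eq_coeff_prod_diagonal:
  fixes P :: "'a::idom poly mat"
  assumes P: "P \<in> carrier_mat n n"
    and diag: "\<And>i. i < n \<Longrightarrow> degree (P $$ (i, i)) \<le> m"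
    and offdiag: "\<And>i j. i < n \<Longrightarrow> j < n \<Longrightarrow> i \<noteq> j \<Longrightarrow> degree (P $$ (i, j)) < m"
    and k: "n * m < k + 2"
  shows "coeff (det P) k = coeff (\<Prod>i<n. P $$ (i, i)) k"
proof -
  have vanish: "coeff (signof p * (\<Prod>i = 0..<n. P $$ (i, p i))) k = 0"
    if "p permutes {0..<n}" "p \<noteq> id" for p
  proof -
    have "coeff (\<Prod>i = 0..<n. P $$ (i, p i)) k = 0"
      using degree_prod_permutation[OF that diag offdiag] k by (intro coeff_eq_0) simp
    then show ?thesis by (cases "sign p = 1") (simp_all add: sign_def)
  qed
  have "coeff (det P) k
      = (\<Sum>p\<in>{p. p permutes {0..<n}}. coeff (signof p * (\<Prod>i = 0..<n. P $$ (i, p i))) k)"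
    by (simp add: det_def'[OF P] coeff_sum)
  also have "\<dots> = (\<Sum>p\<in>{id}. coeff (signof p * (\<Prod>i = 0..<n. P $$ (i, p i))) k)"
    using vanish by (intro sum.mono_neutral_right) (auto simp: finite_permutations permutes_id)
  finally show ?thesis by (simp add: lessThan_atLeast0)
qed

text \<open>Evaluation is a ring homomorphism and so commutes with \<open>det\<close>; hence the
  eigenvalues are the roots of \<open>det P\<close>.\<close>

lemma det_eval_mat_poly: "det (eval_mat_poly P z) = poly (det P) z"
proof -
  interpret comm_ring_hom "\<lambda>p. poly p z" by unfold_locales auto
  show ?thesis by (simp add: eval_mat_poly_def hom_det)
qed

theorem theorem3p1:
  fixes n m :: nat and A :: "nat \<Rightarrow> complex mat" and P :: "complex poly mat"
  assumes "n \<ge> 1" and "m \<ge> 1"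
    and "\<And>l. l < m \<Longrightarrow> A l \<in> carrier_mat n n"
    and "A m = 1\<^sub>m n"
    and "P = mat_poly n m A"
  shows "(\<Sum>z\<in>mp_eigenvalues P. of_nat (alg_mult P z) * z)
       = sum_mset (proots (\<Prod>i<n. P $$ (i, i)))"
proof -
  let ?Q = "\<Prod>i<n. P $$ (i, i)"
  have P: "P \<in> carrier_mat n n" using assms(5) by (simp add: mat_poly_def)
  have coeff_P: "coeff (P $$ (i, j)) k = (if k \<le> m then A k $$ (i, j) else 0)"
    if "i < n" "j < n" for i j k
    using that assms(5) by (simp add: mat_poly_def coeff_sum)
  have diag_le: "degree (P $$ (i, i)) \<le> m" if "i < n" for i
    using that by (intro degree_le) (simp add: coeff_P)
  have diag_lead: "coeff (P $$ (i, i)) m = 1" if "i < n" for i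
    using that assms(4) by (simp add: coeff_P)
  have diag: "degree (P $$ (i, i)) = m" if "i < n" for i
    using diag_le[OF that] diag_lead[OF that] by (intro antisym le_degree) auto
  have offdiag: "degree (P $$ (i, j)) < m" if "i < n" "j < n" "i \<noteq> j" for i j
  proof -
    \<comment> \<open>The coefficient in degree \<open>m\<close> is an off-diagonal entry of the
      identity matrix, hence 0.\<close>
    have "degree (P $$ (i, j)) \<le> m - 1"
    proof (intro degree_le allI impI)
      fix k assume "m - 1 < k"
      then show "coeff (P $$ (i, j)) k = 0"
        using that assms(4) by (cases "k = m") (auto simp: coeff_P)
    qed
    then show ?thesis using assms(2) by simp
  qed
  note coeff_eq = coeff_det_eq_coeff_prod_diagonal[OF P diag_le offdiag]
  have "\<forall>i\<in>{..<n}. P $$ (i, i) \<noteq> 0" using diag_lead by force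
  then have deg_Q: "degree ?Q = n * m"
    by (subst degree_prod_eq_sum_degree) (auto simp: diag)
  have lead_Q: "lead_coeff ?Q = 1"
    by (simp add: lead_coeff_prod diag diag_lead)
  have "degree (det P) \<le> n * m"
    using deg_Q by (intro degree_le) (auto simp: coeff_eq coeff_eq_0)
  moreover have lead: "coeff (det P) (n * m) = 1"
    using lead_Q deg_Q by (simp add: coeff_eq)
  ultimately have deg_det: "degree (det P) = n * m"
    by (intro antisym le_degree) auto
  have "(\<Sum>z\<in>mp_eigenvalues P. of_nat (alg_mult P z) * z) = sum_mset (proots (det P))"
    \<comment> \<open>The coefficient 1 in \<open>lead\<close> ensures that \<open>det P\<close> is
      nonzero.\<close>
    using lead by (subst sum_mset_proots)
      (auto simp: mp_eigenvalues_def alg_mult_def det_eval_mat_poly)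
  also have "\<dots> = - coeff (pCons 0 (det P)) (n * m)"
    using sum_mset_proots_monic[of "det P"] lead deg_det by simp
  \<comment> \<open>For positive \<open>n * m\<close> this compares the coefficients at
    \<open>n * m - 1\<close>; at 0 both sides vanish because of \<open>pCons 0\<close>.\<close>
  also have "\<dots> = - coeff (pCons 0 ?Q) (n * m)"
    using coeff_eq[of "n * m - 1"] by (cases "n * m") auto
  also have "\<dots> = sum_mset (proots ?Q)"
    using sum_mset_proots_monic[OF lead_Q] deg_Q by simp
  finally show ?thesis .
qed

end
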